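(* Let $n=pqr$ with $2<p<q<r$ odd primes, and write $\Phi_n(x)=\sum_{k\ge 0}a_n(k)x^k$. Then for every integer $k\ge 1$ we have $|a_n(k)-a_n(k-1)|\le 1$.
   Context: $\Phi_n(x)=\prod_{1\le j\le n,\ (j,n)=1}(x-\zeta_n^j)$ denotes the $n$th cyclotomic polynomial, where $\zeta_n$ is a primitive $n$th root of unity; $a_n(k)$ is the coefficient of $x^k$ in $\Phi_n(x)$ (so $a_n(k)=0$ for $k>\varphi(n)$). *)

theory Defs
  imports Complex_Main "HOL-Computational_Algebra.Polynomial"
begin

definition zeta_root :: "nat \<Rightarrow> complex" where
  "zeta_root n = cis (2 * pi / real n)"

(* Defined over the complex numbers, as a product of linear factors; that the
   coefficients are integers is a theorem, not part of the definition. *)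
definition cyclotomic :: "nat \<Rightarrow> complex poly" where
  "cyclotomic n = (\<Prod>j\<in>{j. 1 \<le> j \<and> j \<le> n \<and> coprime j n}. [:- (zeta_root n ^ j), 1:])"

definition cyclotomic_coeff :: "nat \<Rightarrow> nat \<Rightarrow> complex" where
  "cyclotomic_coeff n k = coeff (cyclotomic n) k"

end

theory Submission
  imports Defs "HOL-Computational_Algebra.Computational_Algebra" "HOL-Number_Theory.Cong"
begin

text \<open>
  Since \<open>\<Phi>\<^sub>p\<^sub>q\<^sub>r(x) = \<Phi>\<^sub>p\<^sub>q(x\<^sup>r) / \<Phi>\<^sub>p\<^sub>q(x)\<close>, we have
  \<open>(1 - x) \<Phi>\<^sub>p\<^sub>q\<^sub>r(x) = (1 - x\<^sup>p) (1 - x\<^sup>q) T(x)\<close> with \<open>T(x) = \<Phi>\<^sub>p\<^sub>q(x\<^sup>r) / (1 - x\<^sup>p\<^sup>q)\<close>, so a jump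
  is \<open>T\<^sub>k - T\<^sub>k\<^sub>-\<^sub>p - T\<^sub>k\<^sub>-\<^sub>q + T\<^sub>k\<^sub>-\<^sub>p\<^sub>-\<^sub>q\<close>. Here \<open>T\<^sub>m\<close> is the coefficient of \<open>\<Phi>\<^sub>p\<^sub>q\<close> at the \<open>i < pq\<close>
  with \<open>ri \<equiv> m (mod pq)\<close>, or \<open>0\<close> if \<open>ri > m\<close>. Writing \<open>i \<equiv> ap + bq\<close>, the coefficient of
  \<open>\<Phi>\<^sub>p\<^sub>q\<close> at \<open>i\<close> is \<open>[a < \<mu>] + [b < \<lambda>] - 1\<close>, where \<open>p\<mu> + q\<lambda> = pq + 1\<close>, and the four indices are
  the corners of a rectangle in the \<open>(a, b)\<close> grid. As the weight is a function of \<open>a\<close> plus a function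
  of \<open>b\<close>, the jump can exceed \<open>1\<close> only if all four weights agree and opposite corners are both kept
  while the other two are both dropped. But then \<open>i\<close> is additive too, so the four truncation
  conditions \<open>ri \<le> m\<close> contradict each other when summed over opposite corners.
\<close>

section \<open>The cyclotomic polynomial of order \<open>p * q * r\<close> in terms of
  binomials\<close>

text \<open>Both sides have degree at most \<open>m\<close>, the same coefficient at
  \<open>m\<close>, and agree at the \<open>m\<close> roots of unity of order dividing
  \<open>m\<close>, so they are equal.\<close>

lemma prod_linear_factors_zeta_root:
  assumes "m > 0"
  shows "(\<Prod>j\<in>{1..m}. [:- (zeta_root m ^ j), 1:]) = monom 1 m - 1" (is "?P = _")
proof (rule poly_eqI_degree_lead_coeff[where n = m and A = "{z. z ^ m = 1}"])
  have deg: "degree ?P = m"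
    by (subst degree_prod_eq_sum_degree) auto
  then show "degree ?P \<le> m" by simp
  have "lead_coeff ?P = 1"
    by (simp add: lead_coeff_prod)
  with deg show "coeff ?P m = coeff (monom 1 m - 1) m"
    using assms by simp
  show "m \<le> card {z::complex. z ^ m = 1}"
    using card_roots_unity_eq[OF assms] by simp
  show "degree (monom 1 m - 1 :: complex poly) \<le> m"
    by (rule order.trans[OF degree_diff_le_max]) (simp add: degree_monom_le)
  fix z :: complex
  assume "z \<in> {z. z ^ m = 1}"
  then have z: "z ^ m = 1" by simp
  then obtain k where k: "k < m" "z = cis (2 * pi * real k / real m)"
    using bij_betw_imp_surj_on[OF bij_betw_roots_unity[OF assms]] by blast
  have zk: "z = zeta_root m ^ k"
    unfolding zeta_root_def k Complex.DeMoivre by (simp add: mult_ac)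
  have one: "zeta_root m ^ m = 1"
    unfolding zeta_root_def Complex.DeMoivre using assms by simp
  \<comment> \<open>The roots are indexed from \<open>0\<close>, the product from \<open>1\<close>:
    the root \<open>1\<close> is found at \<open>j = m\<close>.\<close>
  have "\<exists>j\<in>{1..m}. z = zeta_root m ^ j"
  proof (cases "k = 0")
    case True
    with zk one assms show ?thesis by (intro bexI[of _ m]) auto
  next
    case False
    with zk k show ?thesis by (intro bexI[of _ k]) auto
  qed
  then have "poly ?P z = 0"
    by (auto simp: poly_prod)
  with z show "poly ?P z = poly (monom 1 m - 1) z"
    by (simp add: poly_monom)
qed

lemma prod_linear_factors_zeta_root_dvd:
  assumes "n > 0" "d dvd n"
  shows "(\<Prod>j\<in>{1..n}. if d dvd j then [:- (zeta_root n ^ j), 1:] else 1) = monom 1 (n div d) - 1"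
proof -
  from assms obtain m where n: "n = d * m" by blast
  with assms have pos: "d > 0" "m > 0" by auto
  have zeta: "zeta_root n ^ (d * i) = zeta_root m ^ i" for i
    unfolding zeta_root_def Complex.DeMoivre n using pos by (simp add: field_simps)
  have set: "{j \<in> {1..n}. d dvd j} = (*) d ` {1..m}"
    using pos unfolding n by (auto elim!: dvdE)
  have "(\<Prod>j\<in>{1..n}. if d dvd j then [:- (zeta_root n ^ j), 1:] else 1)
      = (\<Prod>j\<in>(*) d ` {1..m}. [:- (zeta_root n ^ j), 1:])"
    unfolding set[symmetric] by (rule prod.inter_filter[symmetric]) simp
  also have "\<dots> = (\<Prod>i\<in>{1..m}. [:- (zeta_root n ^ (d * i)), 1:])"
    using pos by (subst prod.reindex) (auto simp: inj_on_def)
  also have "\<dots> = monom 1 m - 1"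
    unfolding zeta using prod_linear_factors_zeta_root[OF pos(2)] .
  finally show ?thesis using n pos by simp
qed

text \<open>Inclusion-exclusion over which of the three primes divide \<open>j\<close>: each factor
  \<open>[:- (zeta_root n ^ j), 1:]\<close> occurs equally often on both sides. All divisions are
  cleared.\<close>

lemma cyclotomic_three_primes:
  assumes "prime p" "prime q" "prime r" "p \<noteq> q" "p \<noteq> r" "q \<noteq> r"
  shows "cyclotomic (p * q * r) * (monom 1 (q * r) - 1) * (monom 1 (p * r) - 1)
           * (monom 1 (p * q) - 1) * (monom 1 1 - 1)
         = (monom 1 (p * q * r) - 1) * (monom 1 r - 1) * (monom 1 q - 1) * (monom 1 p - 1)"
    (is "?L = ?R")
proof -
  define n where "n = p * q * r"
  \<comment> \<open>Filling up with factors \<open>1\<close> gives all these products the same index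
    set, so that they can be compared factor by factor.\<close>
  define Q where "Q P = (\<Prod>j\<in>{1..n}. if P j then [:- (zeta_root n ^ j), 1:] else 1)"
    for P :: "nat \<Rightarrow> bool"
  note primes = assms(1-3)[THEN prime_gt_0_nat]
  have pos: "n > 0" unfolding n_def using primes by simp
  have Q: "Q (\<lambda>j. d dvd j) = monom 1 (n div d) - 1" if "d dvd n" for d
    unfolding Q_def using prod_linear_factors_zeta_root_dvd[OF pos that] .
  have cop: "coprime p q" "coprime p r" "coprime q r"
    using assms by (auto intro: primes_coprime)
  have pq: "p * q dvd j \<longleftrightarrow> p dvd j \<and> q dvd j"
    and pr: "p * r dvd j \<longleftrightarrow> p dvd j \<and> r dvd j"
    and qr: "q * r dvd j \<longleftrightarrow> q dvd j \<and> r dvd j" for j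
    using cop by (auto intro: divides_mult dvd_mult_left dvd_mult_right)
  have pqr: "p * q * r dvd j \<longleftrightarrow> p dvd j \<and> q dvd j \<and> r dvd j" for j
    using divides_mult[of "p * q" j r] cop pq[of j]
    by (auto simp: coprime_mult_left_iff intro: dvd_mult_left dvd_mult_right)
  have coprime: "coprime j n \<longleftrightarrow> \<not> p dvd j \<and> \<not> q dvd j \<and> \<not> r dvd j" for j
    unfolding n_def using assms(1-3)
    by (auto simp: coprime_mult_right_iff prime_imp_coprime coprime_commute[of j]
        dest: coprime_common_divisor_nat)
  have cyc: "cyclotomic n = Q (\<lambda>j. coprime j n)"
    unfolding cyclotomic_def Q_def
    by (subst prod.inter_filter[symmetric]) (auto intro: prod.cong)
  have "Q (\<lambda>j. coprime j n) * Q (\<lambda>j. p dvd j) * Q (\<lambda>j. q dvd j) * Q (\<lambda>j. r dvd j)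
          * Q (\<lambda>j. p * q * r dvd j)
      = Q (\<lambda>j. 1 dvd j) * Q (\<lambda>j. p * q dvd j) * Q (\<lambda>j. p * r dvd j) * Q (\<lambda>j. q * r dvd j)"
    unfolding Q_def prod.distrib[symmetric] pqr coprime
    by (intro prod.cong refl) (auto simp: pq pr qr)
  moreover have "n div p = q * r" "n div q = p * r" "n div r = p * q" "n div (p * q * r) = 1"
    "n div (p * q) = r" "n div (p * r) = q" "n div (q * r) = p" "n div 1 = n"
    unfolding n_def using primes
    by simp_all
  moreover have "p dvd n" "q dvd n" "r dvd n" "p * q * r dvd n" "p * q dvd n" "p * r dvd n"
    "q * r dvd n" "1 dvd n"
    unfolding n_def by auto
  ultimately show ?thesis
    unfolding cyc[folded n_def] n_def[symmetric] by (simp only: Q)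
qed

section \<open>Residues modulo \<open>n\<close>\<close>

lemma eq_of_dvd_diff:
  fixes c a n :: nat
  assumes "int n dvd int c - int a" "c < n" "a < n"
  shows "c = a"
proof -
  have "[c = a] (mod n)"
    using assms(1) by (simp only: cong_iff_dvd_diff[symmetric] cong_int_iff)
  then show ?thesis
    using assms(2,3) by (rule cong_less_modulus_unique_nat)
qed

lemma residue_exists:
  assumes "n > 0" "coprime u n"
  shows "\<exists>a<n. int n dvd m - int u * int a"
proof -
  have "coprime (int u) (int n)" using assms by simp
  then obtain x where "[int u * x = 1] (mod int n)"
    using cong_solve_coprime_int by blast
  then have "[int u * (x * m) = m] (mod int n)"
    using cong_scalar_right[of "int u * x" 1 "int n" m] by (simp add: mult.assoc)
  then have "[int u * ((x * m) mod int n) = m] (mod int n)"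
    by (simp add: cong_def mod_mult_right_eq)
  then have "int n dvd m - int u * int (nat ((x * m) mod int n))"
    using assms by (simp add: cong_iff_dvd_diff dvd_diff_commute)
  moreover have "nat ((x * m) mod int n) < n"
    using assms by (simp add: nat_less_iff)
  ultimately show ?thesis by blast
qed

section \<open>The polynomial of order \<open>p * q\<close> as a sum over a grid\<close>

text \<open>By \<open>bezout\<close>, \<open>mu\<close> inverts \<open>p\<close> modulo
  \<open>q\<close> and \<open>la\<close> inverts \<open>q\<close> modulo \<open>p\<close>.\<close>

locale coprime_grid =
  fixes p q r mu la :: nat
  assumes pos: "p > 0" "q > 0" "r > 0"
    and cop: "coprime p q" "coprime p r" "coprime q r"
    and bezout: "p * mu + q * la = p * q + 1"
    and le: "mu \<le> q" "la \<le> p"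
begin

text \<open>
  On grid points of nonzero weight, \<open>expo a b\<close> is the representative of \<open>ap + bq\<close> in \<open>[0, pq)\<close> and
  \<open>weight a b\<close> the coefficient of \<open>\<Phi>\<^sub>p\<^sub>q\<close> there; elsewhere \<open>expo\<close> may be negative.
\<close>

definition weight :: "nat \<Rightarrow> nat \<Rightarrow> int" where
  "weight a b = of_bool (a < mu) + of_bool (b < la) - 1"

definition expo :: "nat \<Rightarrow> nat \<Rightarrow> int" where
  "expo a b = int a * int p + int b * int q - (if a < mu then 0 else int p * int q)"

definition grid :: "(nat \<times> nat) set" where
  "grid = {..<q} \<times> {..<p}"

text \<open>The coefficients of \<open>\<Phi>\<^sub>p\<^sub>q(x\<^sup>r) / (1 - x\<^sup>p\<^sup>q)\<close>, extended by zero to negative indices.\<close>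

definition trunc :: "int \<Rightarrow> int" where
  "trunc m = (\<Sum>(a, b)\<in>grid. weight a b *
     of_bool (int r * expo a b \<le> m \<and> int p * int q dvd m - int r * expo a b))"

text \<open>Where \<open>p * q\<close> is subtracted and the weight is nonzero,
  \<open>a \<ge> mu\<close> and \<open>b \<ge> la\<close>, so \<open>bezout\<close> gives
  \<open>a * p + b * q > p * q\<close>.\<close>

lemma expo_nonneg:
  assumes "weight a b \<noteq> 0"
  shows "expo a b \<ge> 0"
proof (cases "a < mu")
  case True
  then show ?thesis by (simp add: expo_def)
next
  case False
  with assms have "la \<le> b" "mu \<le> a" by (auto simp: weight_def)
  then have "p * mu + q * la \<le> a * p + b * q"
    by (metis add_mono mult.commute mult_le_mono1)
  then have "int (p * q + 1) \<le> int (a * p + b * q)"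
    unfolding bezout by linarith
  with False show ?thesis by (simp add: expo_def)
qed

text \<open>This identifies the grid sum with the cyclotomic polynomial of order
  \<open>p * q\<close>, denominators cleared. The weight is \<open>1\<close> on one rectangle,
  \<open>-1\<close> on the opposite one and \<open>0\<close> elsewhere, so the sum is a difference
  of two products of geometric sums. The general ring allows \<open>y\<close> to be a power of the
  series variable.\<close>

lemma grid_sum_identity:
  fixes y :: "'a :: comm_ring_1"
  shows "(\<Sum>(a, b)\<in>grid. of_int (weight a b) * y ^ nat (expo a b)) * (1 - y ^ p) * (1 - y ^ q)
       = (1 - y) * (1 - y ^ (p * q))"
proof -
  let ?f = "\<lambda>(a, b). of_int (weight a b) * y ^ nat (expo a b)"
  let ?P = "{..<mu} \<times> {..<la}" and ?N = "{mu..<q} \<times> {la..<p}"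
  have geo: "(1 - z ^ d) * (\<Sum>i<k. (z ^ i) ^ d) = 1 - z ^ (d * k)" for z :: 'a and d k
    using one_diff_power_eq[of "z ^ d" k] by (simp add: power_mult[symmetric] mult.commute)
  have "sum ?f grid = sum ?f (?P \<union> ?N)"
    using le unfolding grid_def
    by (intro sum.mono_neutral_right) (auto simp: weight_def of_bool_def split: if_splits)
  also have "\<dots> = sum ?f ?P + sum ?f ?N"
    by (rule sum.union_disjoint) auto
  also have "sum ?f ?P = (\<Sum>(a, b)\<in>?P. (y ^ a) ^ p * (y ^ b) ^ q)"
  proof (intro sum.cong refl)
    fix x assume "x \<in> ?P"
    then obtain a b where x: "x = (a, b)" "a < mu" "b < la" by auto
    then have "weight a b = 1" "expo a b = int (a * p + b * q)"
      by (auto simp: weight_def expo_def)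
    then show "?f x = (case x of (a, b) \<Rightarrow> (y ^ a) ^ p * (y ^ b) ^ q)"
      unfolding x by (simp only: prod.case nat_int power_add power_mult) simp
  qed
  also have "\<dots> = (\<Sum>a<mu. (y ^ a) ^ p) * (\<Sum>b<la. (y ^ b) ^ q)"
    by (simp add: sum_product sum.cartesian_product)
  \<comment> \<open>Translating by \<open>(mu, la)\<close> adds \<open>p * q + 1\<close> to the
    exponent by \<open>bezout\<close>; \<open>expo\<close> takes off \<open>p * q\<close>, which
    leaves one extra factor \<open>y\<close>.\<close>
  also have "sum ?f ?N = (\<Sum>(a, b)\<in>{..<q - mu} \<times> {..<p - la}. - y * ((y ^ a) ^ p * (y ^ b) ^ q))"
    (is "_ = sum ?g _")
  proof (rule sum.reindex_bij_witness[where j = "\<lambda>(a, b). (a - mu, b - la)"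
        and i = "\<lambda>(a, b). (a + mu, b + la)"])
    let ?i = "\<lambda>(a, b). (a + mu, b + la)" and ?j = "\<lambda>(a, b). (a - mu, b - la)"
    fix x
    show "?i (?j x) = x" "?j x \<in> {..<q - mu} \<times> {..<p - la}" if "x \<in> ?N"
      using that by auto
    show "?j (?i x) = x" "?i x \<in> ?N" if "x \<in> {..<q - mu} \<times> {..<p - la}"
      using that by auto
    assume "x \<in> ?N"
    then obtain c d where x: "x = (c + mu, d + la)"
      by (auto dest!: le_Suc_ex simp: add.commute)
    have "int p * int mu + int q * int la = int p * int q + 1"
      using bezout by (metis of_nat_1 of_nat_add of_nat_mult)
    then have "expo (c + mu) (d + la) = int (c * p + d * q + 1)"
      by (simp add: expo_def algebra_simps)
    moreover have "weight (c + mu) (d + la) = - 1"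
      by (simp add: weight_def)
    ultimately have "of_int (weight (c + mu) (d + la)) * y ^ nat (expo (c + mu) (d + la))
        = - y * ((y ^ c) ^ p * (y ^ d) ^ q)"
      by (simp only: nat_int power_add power_mult) (simp add: mult_ac)
    then show "?g (?j x) = ?f x"
      unfolding x by simp
  qed
  also have "\<dots> = - y * (\<Sum>(a, b)\<in>{..<q - mu} \<times> {..<p - la}. (y ^ a) ^ p * (y ^ b) ^ q)"
    by (simp add: sum_distrib_left case_prod_unfold)
  also have "\<dots> = - y * ((\<Sum>a<q - mu. (y ^ a) ^ p) * (\<Sum>b<p - la. (y ^ b) ^ q))"
    by (simp only: sum_product sum.cartesian_product)
  finally have sum: "sum ?f grid = (\<Sum>a<mu. (y ^ a) ^ p) * (\<Sum>b<la. (y ^ b) ^ q)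
      + - y * ((\<Sum>a<q - mu. (y ^ a) ^ p) * (\<Sum>b<p - la. (y ^ b) ^ q))" .
  have "sum ?f grid * (1 - y ^ p) * (1 - y ^ q)
      = ((1 - y ^ p) * (\<Sum>a<mu. (y ^ a) ^ p)) * ((1 - y ^ q) * (\<Sum>b<la. (y ^ b) ^ q))
        - y * ((1 - y ^ p) * (\<Sum>a<q - mu. (y ^ a) ^ p)) * ((1 - y ^ q) * (\<Sum>b<p - la. (y ^ b) ^ q))"
    unfolding sum by (simp add: algebra_simps)
  also have "\<dots> = (1 - y ^ (p * mu)) * (1 - y ^ (q * la))
      - y * (1 - y ^ (p * (q - mu))) * (1 - y ^ (q * (p - la)))"
    unfolding geo ..
  also have "\<dots> = (1 - y) * (1 - y ^ (p * q))"
  proof -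
    \<comment> \<open>Since \<open>1 + p * (q - mu) = q * la\<close> and
      \<open>1 + q * (p - la) = p * mu\<close>, the powers with these exponents cancel between the
      two products.\<close>
    have le': "p * mu \<le> p * q" "q * la \<le> p * q"
      using le by auto
    have "y * y ^ (p * (q - mu)) = y ^ (p * q + 1 - p * mu)"
      using le' by (simp add: diff_mult_distrib2 Suc_diff_le flip: power_Suc)
    then have 1: "y * y ^ (p * (q - mu)) = y ^ (q * la)"
      unfolding bezout[symmetric] by simp
    have "y * y ^ (q * (p - la)) = y ^ (p * q + 1 - q * la)"
      using le' by (simp add: diff_mult_distrib2 Suc_diff_le mult.commute flip: power_Suc)
    then have 2: "y * y ^ (q * (p - la)) = y ^ (p * mu)"
      unfolding bezout[symmetric] by simp
    have "q * la + q * (p - la) = p * q"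
      using le by (metis distrib_left le_add_diff_inverse mult.commute)
    then have 3: "y ^ (q * la) * y ^ (q * (p - la)) = y ^ (p * q)"
      unfolding power_add[symmetric] by simp
    have 4: "y ^ (p * mu) * y ^ (q * la) = y * y ^ (p * q)"
      unfolding power_add[symmetric] bezout by simp
    have "y * (1 - A) * (1 - B) = y - y * A - y * B + y * A * B" for A B
      by (simp add: algebra_simps)
    then have 5: "y * (1 - y ^ (p * (q - mu))) * (1 - y ^ (q * (p - la)))
        = y - y ^ (q * la) - y ^ (p * mu) + y ^ (p * q)"
      by (simp only: 1 2 3)
    have 6: "(1 - y ^ (p * mu)) * (1 - y ^ (q * la)) = 1 - y ^ (p * mu) - y ^ (q * la) + y * y ^ (p * q)"
      unfolding 4[symmetric] by (simp add: algebra_simps)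
    show ?thesis unfolding 5 6 by (simp add: algebra_simps)
  qed
  finally show ?thesis .
qed

section \<open>The truncated coefficients and their double difference\<close>

lemma trunc_neg: "m < 0 \<Longrightarrow> trunc m = 0"
  unfolding trunc_def
proof (intro sum.neutral, clarify)
  fix a b assume "m < 0"
  show "weight a b * of_bool (int r * expo a b \<le> m \<and> int p * int q dvd m - int r * expo a b) = 0"
  proof (cases "weight a b = 0")
    case False
    with expo_nonneg[of a b] have "int r * expo a b \<ge> 0" by simp
    with \<open>m < 0\<close> show ?thesis by simp
  qed simp
qed

text \<open>Coefficient form of multiplying by \<open>1 - x ^ (p * q)\<close>: each grid point
  contributes along a progression of step \<open>p * q\<close>, and the shift cancels all but its
  first term.\<close>

lemma trunc_diff:
  "trunc m - trunc (m - int p * int q) = (\<Sum>(a, b)\<in>grid. weight a b * of_bool (int r * expo a b = m))"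
  unfolding trunc_def sum_subtractf[symmetric]
proof (intro sum.cong refl, clarify)
  fix a b
  define e N where "e = int r * expo a b" and "N = int p * int q"
  have N: "N > 0" using pos by (simp add: N_def)
  have "N dvd m - N - e \<longleftrightarrow> N dvd m - e"
    using dvd_add_left_iff[of N N "m - N - e"] by simp
  moreover have "m - e < N \<Longrightarrow> e \<le> m \<Longrightarrow> N dvd m - e \<Longrightarrow> e = m"
    using zdvd_imp_le[of N "m - e"] by linarith
  ultimately have "of_bool (e \<le> m \<and> N dvd m - e) - of_bool (e \<le> m - N \<and> N dvd m - N - e)
      = (of_bool (e = m) :: int)"
    using N by (auto simp: of_bool_def)
  then show "weight a b * of_bool (int r * expo a b \<le> m \<and> int p * int q dvd m - int r * expo a b)
      - weight a b * of_bool (int r * expo a b \<le> m - int p * int q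
          \<and> int p * int q dvd m - int p * int q - int r * expo a b)
      = weight a b * of_bool (int r * expo a b = m)"
    unfolding e_def N_def by (simp flip: right_diff_distrib)
qed

text \<open>By the Chinese remainder theorem a single grid point matches the residue of
  \<open>m\<close>. The hypothesis may omit the correction in \<open>expo\<close>, a multiple of
  \<open>p * q\<close>.\<close>

lemma trunc_eq:
  assumes ab: "a < q" "b < p"
    and m: "int p * int q dvd m - int r * (int a * int p + int b * int q)"
  shows "trunc m = weight a b * of_bool (int r * expo a b \<le> m)"
proof -
  let ?v = "\<lambda>a b. int a * int p + int b * int q"
  have expo: "int p * int q dvd m - int r * expo c d \<longleftrightarrow> int p * int q dvd m - int r * ?v c d"
    for c d
  proof -
    have "m - int r * expo c d = m - int r * ?v c d
        + int p * int q * (if c < mu then 0 else int r)"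
      by (simp add: expo_def algebra_simps)
    then show ?thesis by (simp only: dvd_add_left_iff[OF dvd_triv_left])
  qed
  have uniq: "(c, d) = (a, b)"
    if cd: "c < q" "d < p" "int p * int q dvd m - int r * ?v c d" for c d
  proof -
    have "int p * int q dvd int r * ?v c d - int r * ?v a b"
      using dvd_diff[OF m cd(3)] by simp
    then have *: "int p * int q dvd int r * int p * (int c - int a) + int r * int q * (int d - int b)"
      by (simp add: algebra_simps)
    \<comment> \<open>Modulo \<open>q\<close> only the first coordinate survives, with a factor
      \<open>r * p\<close> coprime to \<open>q\<close>; modulo \<open>p\<close> only the
      second.\<close>
    from * have "int q dvd int r * int p * (int c - int a) + int r * int q * (int d - int b)"
      by (rule dvd_mult_right)
    then have "int q dvd int r * int p * (int c - int a)"
      by (subst (asm) dvd_add_left_iff) auto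
    then have "int q dvd int c - int a"
      using cop by (simp add: coprime_dvd_mult_right_iff ac_simps coprime_commute)
    then have c: "c = a"
      using eq_of_dvd_diff ab cd by blast
    from * have "int p dvd int r * int p * (int c - int a) + int r * int q * (int d - int b)"
      by (rule dvd_mult_left)
    then have "int p dvd int r * int q * (int d - int b)"
      by (subst (asm) dvd_add_right_iff) auto
    then have "int p dvd int d - int b"
      using cop by (simp add: coprime_dvd_mult_right_iff ac_simps coprime_commute)
    then have "d = b"
      using eq_of_dvd_diff ab cd by blast
    with c show ?thesis by simp
  qed
  have "trunc m = (\<Sum>x\<in>grid. if x = (a, b) then weight a b * of_bool (int r * expo a b \<le> m) else 0)"
    unfolding trunc_def
  proof (intro sum.cong refl, clarify)
    fix c d assume "(c, d) \<in> grid"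
    then show "weight c d * of_bool (int r * expo c d \<le> m \<and> int p * int q dvd m - int r * expo c d)
      = (if (c, d) = (a, b) then weight a b * of_bool (int r * expo a b \<le> m) else 0)"
    proof (cases "(c, d) = (a, b)")
      case True
      with m show ?thesis by (simp only: prod.inject expo if_True simp_thms)
    next
      case False
      with uniq[of c d] \<open>(c, d) \<in> grid\<close> have "\<not> int p * int q dvd m - int r * ?v c d"
        by (auto simp only: grid_def mem_Sigma_iff lessThan_iff)
      with False show ?thesis by (simp only: expo if_False simp_thms of_bool_eq mult_zero_right)
    qed
  qed
  also have "\<dots> = weight a b * of_bool (int r * expo a b \<le> m)"
    using ab by (simp add: grid_def)
  finally show ?thesis .
qed

lemma double_difference_bound:
  "\<bar>trunc k - trunc (k - int p) - trunc (k - int q) + trunc (k - int p - int q)\<bar> \<le> 1"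
proof -
  have copq: "coprime (r * p) q" and copp: "coprime (r * q) p" and cr: "coprime r q" "coprime r p"
    using cop by (auto simp: coprime_commute)
  \<comment> \<open>\<open>(a, b)\<close> are the grid coordinates of \<open>k\<close>. Passing to
    \<open>k - p\<close> replaces only \<open>a\<close> by \<open>a'\<close>, with
    \<open>r * a'\<close> congruent to \<open>r * a - 1\<close> modulo \<open>q\<close>; passing to
    \<open>k - q\<close> replaces only \<open>b\<close> by \<open>b'\<close>.\<close>
  obtain a where a: "a < q" "int q dvd k - int (r * p) * int a"
    using residue_exists[OF pos(2) copq] by blast
  obtain b where b: "b < p" "int p dvd k - int (r * q) * int b"
    using residue_exists[OF pos(1) copp] by blast
  obtain a' where a': "a' < q" "int q dvd (int r * int a - 1) - int r * int a'"
    using residue_exists[OF pos(2) cr(1)] by blast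
  obtain b' where b': "b' < p" "int p dvd (int r * int b - 1) - int r * int b'"
    using residue_exists[OF pos(1) cr(2)] by blast
  let ?N = "int p * int q"
  let ?v = "\<lambda>a b. int r * (int a * int p + int b * int q)"
  have "k - ?v a b = (k - int (r * p) * int a) - int q * (int r * int b)"
    "k - ?v a b = (k - int (r * q) * int b) - int p * (int r * int a)"
    by (simp_all add: algebra_simps)
  then have "int q dvd k - ?v a b" "int p dvd k - ?v a b"
    using a(2) b(2) by (metis dvd_diff dvd_triv_left)+
  then have 1: "?N dvd k - ?v a b"
    using cop(1) by (intro divides_mult) auto
  have da: "?N dvd int p * ((int r * int a - 1) - int r * int a')"
    using a' by (intro mult_dvd_mono) auto
  have db: "?N dvd int q * ((int r * int b - 1) - int r * int b')"
    using mult_dvd_mono[OF dvd_refl[of "int q"] b'(2)] by (simp add: mult.commute)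
  have "(k - int p) - ?v a' b = (k - ?v a b) + int p * ((int r * int a - 1) - int r * int a')"
    by (simp add: algebra_simps)
  with dvd_add[OF 1 da] have 2: "?N dvd (k - int p) - ?v a' b" by (simp only:)
  have "(k - int q) - ?v a b' = (k - ?v a b) + int q * ((int r * int b - 1) - int r * int b')"
    by (simp add: algebra_simps)
  with dvd_add[OF 1 db] have 3: "?N dvd (k - int q) - ?v a b'" by (simp only:)
  have "(k - int p - int q) - ?v a' b'
      = ((k - int p) - ?v a' b) + int q * ((int r * int b - 1) - int r * int b')"
    by (simp add: algebra_simps)
  with dvd_add[OF 2 db] have 4: "?N dvd (k - int p - int q) - ?v a' b'" by (simp only:)
  \<comment> \<open>In this expanded form the parts depending on \<open>c\<close> and on
    \<open>d\<close> are separate summands, so they cancel linearly between opposite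
    corners.\<close>
  have expo: "int r * expo c d
      = int r * int c * int p + int r * int d * int q - (if c < mu then 0 else int r * ?N)" for c d
    by (simp add: expo_def algebra_simps)
  show ?thesis
    unfolding trunc_eq[OF a(1) b(1) 1] trunc_eq[OF a'(1) b(1) 2] trunc_eq[OF a(1) b'(1) 3]
      trunc_eq[OF a'(1) b'(1) 4] expo weight_def
    \<comment> \<open>If \<open>a, a'\<close> or \<open>b, b'\<close> are separated by their
      threshold, at most one corner enters with each sign. Otherwise the weights are all equal, and
      the inequalities exclude a jump of \<open>2\<close>.\<close>
    by (cases "a < mu"; cases "a' < mu"; cases "b < la"; cases "b' < la")
      (auto simp: of_bool_def)
qed

end

section \<open>Existence of the grid and the passage to power series\<close>

text \<open>\<open>mu\<close> is the inverse of \<open>p\<close> modulo \<open>q\<close>, and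
  \<open>la\<close> is the quotient of \<open>p * q + 1 - p * mu\<close> by \<open>q\<close>. As
  \<open>q > 1\<close>, \<open>mu\<close> is nonzero, which forces
  \<open>la \<le> p\<close>.\<close>

lemma coprime_grid_exists:
  assumes "p > 1" "q > 1" "r > 0" "coprime p q" "coprime p r" "coprime q r"
  shows "\<exists>mu la. coprime_grid p q r mu la"
proof -
  obtain x where x: "[p * x = 1] (mod q)"
    using cong_solve_coprime_nat[OF assms(4)] by auto
  define mu where "mu = x mod q"
  have mu: "[p * mu = 1] (mod q)" "mu < q"
    using x assms by (auto simp: mu_def cong_def mod_mult_right_eq)
  have "mu \<noteq> 0"
    using mu assms by (auto simp: cong_def intro!: Nat.gr0I)
  have "p * mu \<le> p * q" using mu by simp
  have cong: "[p * mu = p * q + 1] (mod q)"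
    using mu(1) mod_mult_self3[of p q 1] unfolding cong_def by (rule trans[OF _ sym])
  have "q dvd p * q + 1 - p * mu"
    by (rule cong_altdef_nat[THEN iffD1, OF trans_le_add1[OF \<open>p * mu \<le> p * q\<close>] cong_sym[OF cong]])
  then obtain la where "p * q + 1 - p * mu = q * la" by blast
  with \<open>p * mu \<le> p * q\<close> have la: "p * mu + q * la = p * q + 1" by linarith
  have "p * 1 \<le> p * mu" using \<open>mu \<noteq> 0\<close> by (intro mult_le_mono) auto
  with la have "q * la \<le> q * p"
    using assms(1) mult.commute[of q p] by linarith
  with assms have "la \<le> p" by simp
  moreover have "p > 0" "q > 0" "mu \<le> q"
    using assms mu by auto
  ultimately have "coprime_grid p q r mu la"
    unfolding coprime_grid_def using assms la by blast
  then show ?thesis by blast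
qed

lemma fps_mult_one_diff_X_power_nth:
  "(f * (1 - fps_X ^ d)) $ k = f $ k - (if k < d then 0 else f $ (k - d))"
  for f :: "'a :: comm_ring_1 fps"
  by (simp add: right_diff_distrib fps_X_power_mult_right_nth)

theorem theorem1:
  fixes p q r n :: nat
  assumes "prime p" and "prime q" and "prime r"
    and "2 < p" and "p < q" and "q < r"
    and "n = p * q * r"
  shows "\<forall>k\<ge>1. cmod (cyclotomic_coeff n k - cyclotomic_coeff n (k - 1)) \<le> 1"
proof (intro allI impI)
  fix k :: nat assume k: "k \<ge> 1"
  have cop: "coprime p q" "coprime p r" "coprime q r"
    using assms by (auto intro!: primes_coprime)
  with assms obtain mu la where "coprime_grid p q r mu la"
    using coprime_grid_exists[of p q r] by auto
  then interpret coprime_grid p q r mu la .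
  define T :: "complex fps" where "T = Abs_fps (\<lambda>i. of_int (trunc (int i)))"
  define F where "F = fps_of_poly (cyclotomic n)"
  let ?X = "fps_X :: complex fps"
  have T: "T * (1 - ?X ^ (p * q))
      = (\<Sum>(a, b)\<in>grid. of_int (weight a b) * (?X ^ r) ^ nat (expo a b))"
  proof (rule fps_ext)
    fix i
    \<comment> \<open>Below index \<open>p * q\<close> the shifted series contributes
      \<open>0\<close>, in accordance with \<open>trunc_neg\<close>.\<close>
    have "(T * (1 - ?X ^ (p * q))) $ i = of_int (trunc (int i) - trunc (int i - int p * int q))"
      unfolding fps_mult_one_diff_X_power_nth
      by (auto simp: T_def trunc_neg of_nat_diff)
        (metis diff_less_0_iff_less of_nat_less_iff of_nat_mult trunc_neg of_int_0)
    also have "\<dots> = (\<Sum>(a, b)\<in>grid. of_int (weight a b) * of_bool (int r * expo a b = int i))"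
      unfolding trunc_diff by (simp add: case_prod_unfold)
    also have "\<dots> = (\<Sum>(a, b)\<in>grid. of_int (weight a b) * (?X ^ r) ^ nat (expo a b)) $ i"
      unfolding fps_sum_nth
    proof (intro sum.cong refl, clarify)
      fix a b
      have "int r * expo a b = int i \<longleftrightarrow> i = r * nat (expo a b)" if "weight a b \<noteq> 0"
        using expo_nonneg[OF that] by (metis int_nat_eq of_nat_eq_iff of_nat_mult)
      then show "of_int (weight a b) * of_bool (int r * expo a b = int i)
          = (of_int (weight a b) * (?X ^ r) ^ nat (expo a b)) $ i"
        by (cases "weight a b = 0")
          (auto simp: fps_of_int[symmetric] power_mult[symmetric])
    qed
    finally show "(T * (1 - ?X ^ (p * q))) $ i
      = (\<Sum>(a, b)\<in>grid. of_int (weight a b) * (?X ^ r) ^ nat (expo a b)) $ i" .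
  qed
  have nz: "1 - ?X ^ d \<noteq> 0" if "d > 0" for d
  proof -
    from that have "(1 - ?X ^ d) $ 0 \<noteq> 0 $ 0" by simp
    then show ?thesis by metis
  qed
  have F: "F * (?X ^ (q * r) - 1) * (?X ^ (p * r) - 1) * (?X ^ (p * q) - 1) * (?X - 1)
      = (?X ^ n - 1) * (?X ^ r - 1) * (?X ^ q - 1) * (?X ^ p - 1)"
    using cyclotomic_three_primes[of p q r, THEN arg_cong[of _ _ fps_of_poly]] assms
    by (simp add: fps_of_poly_mult fps_of_poly_diff fps_of_poly_monom' F_def)
  have G: "T * (1 - ?X ^ (p * q)) * (1 - ?X ^ (p * r)) * (1 - ?X ^ (q * r))
      = (1 - ?X ^ r) * (1 - ?X ^ n)"
    using grid_sum_identity[of "?X ^ r"] unfolding T[symmetric] unfolding power_mult[symmetric] assms(7)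
    by (simp add: ac_simps)
  let ?Z = "(1 - ?X ^ (q * r)) * (1 - ?X ^ (p * r)) * (1 - ?X ^ (p * q))"
  \<comment> \<open>The second equation replaces \<open>(1 - w) * (1 - z)\<close> in the first. The
    common factor \<open>?Z\<close> is then cancelled, as power series over the complex numbers form
    an integral domain.\<close>
  have "E * (1 - x) * ((1 - a) * (1 - b) * (1 - c)) = S * (1 - u) * (1 - v) * ((1 - a) * (1 - b) * (1 - c))"
    if "E * (a - 1) * (b - 1) * (c - 1) * (x - 1) = (z - 1) * (w - 1) * (v - 1) * (u - 1)"
      "S * (1 - c) * (1 - b) * (1 - a) = (1 - w) * (1 - z)"
    for E S a b c u v w x z :: "complex fps"
    using that by algebra
  from this[OF F G] have "(F * (1 - ?X ^ 1)) * ?Z = (T * (1 - ?X ^ p) * (1 - ?X ^ q)) * ?Z"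
    unfolding power_one_right .
  moreover have "?Z \<noteq> 0"
    using pos nz[of "q * r"] nz[of "p * r"] nz[of "p * q"] by auto
  ultimately have eq: "F * (1 - ?X ^ 1) = T * (1 - ?X ^ p) * (1 - ?X ^ q)"
    by simp
  \<comment> \<open>The case distinctions from multiplying by \<open>1 - ?X ^ d\<close> disappear,
    because \<open>trunc\<close> vanishes at negative integers.\<close>
  have shift: "(if i < d then 0 else of_int (trunc (int (i - d) - e)))
      = (of_int (trunc (int i - int d - e)) :: complex)" if "e \<ge> 0" for i d e
    using that by (auto simp: trunc_neg of_nat_diff)
  have "cyclotomic_coeff n k - cyclotomic_coeff n (k - 1) = (F * (1 - ?X ^ 1)) $ k"
    unfolding fps_mult_one_diff_X_power_nth using k
    by (simp add: cyclotomic_coeff_def F_def)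
  also have "\<dots> = of_int (trunc (int k) - trunc (int k - int p) - trunc (int k - int q)
      + trunc (int k - int p - int q))"
    unfolding eq fps_mult_one_diff_X_power_nth T_def fps_nth_Abs_fps
    using shift[of 0 k p] shift[of 0 k q] shift[of 0 "k - q" p] trunc_neg[of "int k - int p - int q"]
    by (auto simp: of_nat_diff algebra_simps)
  finally show "cmod (cyclotomic_coeff n k - cyclotomic_coeff n (k - 1)) \<le> 1"
    using double_difference_bound[of "int k"] by (simp only: norm_of_int)
qed

end
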